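(* The limit $\displaystyle\lim_{n\to\infty}\left(\frac{|s(S_n)|}{n!}\right)^{1/n}$ exists and satisfies \[0.68631<\lim_{n\to\infty}\left(\frac{|s(S_n)|}{n!}\right)^{1/n}<0.75260.\]
   Context: $S_n$ is the set of permutations of $\{1,\dots,n\}$ written in one-line notation. West's stack-sorting map $s$ is defined recursively on permutations of finite sets of positive integers: $s$ of the empty permutation is empty, and if $\pi=LmR$ with $m$ the largest entry of $\pi$, then $s(\pi)=s(L)\,s(R)\,m$. $s(S_n)$ is the image of $S_n$ under $s$. *)

theory Defs
  imports "HOL-Analysis.Analysis" "HOL-Combinatorics.Multiset_Permutations"
begin

text \<open>
  Permutations in one-line notation are distinct lists. The recursion below is total on lists;
  with repeated entries it splits at the first occurrence of the maximum, but only distinct lists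
  are relevant.
\<close>

function stack_sort :: "nat list \<Rightarrow> nat list" where
  "stack_sort \<pi> =
    (if \<pi> = [] then []
     else let m = Max (set \<pi>);
              L = takeWhile (\<lambda>x. x \<noteq> m) \<pi>;
              R = tl (dropWhile (\<lambda>x. x \<noteq> m) \<pi>)
          in stack_sort L @ stack_sort R @ [m])"
  by pat_completeness auto
termination
proof (relation "Wellfounded.measure length", goal_cases)
  case 1
  show ?case by simp
next
  case (2 \<pi> m L R)
  then have "m \<in> set \<pi>" by simp
  then have "dropWhile (\<lambda>x. x \<noteq> m) \<pi> \<noteq> []"
    by (simp add: dropWhile_eq_Nil_conv)
  then have "length (dropWhile (\<lambda>x. x \<noteq> m) \<pi>) > 0" by simp
  moreover have "length L + length (dropWhile (\<lambda>x. x \<noteq> m) \<pi>) = length \<pi>"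
    using 2(3) by (metis length_append takeWhile_dropWhile_id)
  ultimately show ?case unfolding in_measure by linarith
next
  case (3 \<pi> m L R)
  have "length (dropWhile (\<lambda>x. x \<noteq> m) \<pi>) \<le> length \<pi>"
    by (rule length_dropWhile_le)
  then have "length R \<le> length \<pi> - 1" using 3(4) by simp
  moreover have "length \<pi> > 0" using 3(1) by simp
  ultimately show ?case unfolding in_measure by linarith
qed

declare stack_sort.simps [simp del]

lemma stack_sort_Nil [simp]: "stack_sort [] = []"
  by (simp add: stack_sort.simps)

lemma stack_sort_split:
  assumes "\<And>x. x \<in> set L \<Longrightarrow> x < m" and "\<And>x. x \<in> set R \<Longrightarrow> x < m"
  shows "stack_sort (L @ m # R) = stack_sort L @ stack_sort R @ [m]"
proof -
  have M: "Max (set (L @ m # R)) = m"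
    by (rule Max_eqI) (use assms in \<open>auto intro: less_imp_le\<close>)
  have L: "takeWhile (\<lambda>x. x \<noteq> m) (L @ m # R) = L"
    using assms(1) by (subst takeWhile_append2) auto
  have R: "dropWhile (\<lambda>x. x \<noteq> m) (L @ m # R) = m # R"
    using assms(1) by (subst dropWhile_append2) auto
  show ?thesis
    by (subst stack_sort.simps) (simp only: M L R Let_def, simp)
qed

definition S :: "nat \<Rightarrow> nat list set" where
  "S n = permutations_of_set {1..n}"

end

theory Submission
  imports Defs "HOL-Real_Asymp.Real_Asymp"
begin

text \<open>
Call a list sorted if it is a value of \<^const>\<open>stack_sort\<close>. Because $s(LmR) = s(L)\,s(R)\,m$, a
nonempty list is sorted exactly if it ends with its maximum and the rest is a concatenation of two
(possibly empty) sorted lists. Let \<open>blocks w\<close> be the least number of nonempty sorted lists into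
which \<open>w\<close> can be cut. The sorted list that ends with the maximum can absorb two of the sorted lists
in front of it and nothing behind it, so
$\mathrm{blocks}(LmR) = \max(\mathrm{blocks}(L) - 2, 0) + 1 + \mathrm{blocks}(R)$. This recursion is
the definition below; \<open>blocks_append_le\<close> and \<open>blocks_split_at\<close> are the two halves of the
description by cuttings, and \<open>stack_sort_image_eq\<close> identifies the image with \<open>blocks w \<le> 1\<close>.

Let $g_k(x) = \sum_n a_{k,n} x^n$, where $n!\,a_{k,n}$ counts the permutations of $n$ letters with
$k$ blocks, and write $p, q, r, s$ for $g_1, g_2, g_3, g_4$. Splitting at the maximum gives
$p' = 1 + p + q$, $q' = p p' + r$, $r' = q p' + p r + s$, $s' = r p' + q r + p s + g_5$. The numbers
in the theorem are the coefficients of $1 + p$, and $1/L$ is the radius of convergence of $p$. Each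
step below is an inequality between coefficients.

\<^item> The limit exists: $q' \ge p p'$ gives $q \ge p^2 / 2$, hence $p' \ge 1 + p + p^2/2$, and so the
  coefficients are supermultiplicative up to a polynomial factor. Fekete's argument tolerates such
  a factor (\<open>root_limit_of_supermultiplicative\<close>).
\<^item> Upper bound: cutting a list with three blocks after the first one gives $r \le p q$. With this
  the first two equations become a closed system of inequalities for $p$ and $q$, and any
  coefficientwise supersolution of it majorizes $p$ and $q$.
\<^item> Lower bound: $g_5 \ge 0$ closes the system for $p, q, r, s$ in the other direction, and
  subsolutions minorize.

The right-hand sides have nonnegative coefficients, so both comparisons are inductions on the degree
(\<open>le_majorants\<close>, \<open>minorants_le\<close>). The super- and subsolutions are polynomials plus terms with
poles at one point $\rho$, which makes their coefficients times $\rho^n$ polynomials in $n$ apart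
from finitely many. All inequalities to check are then finitely many numerical ones and polynomial
ones in $n$. The poles at $4/3$ and $1.457$ give $1000/1457 \le L \le 3/4$.
\<close>

section \<open>Cutting a list into sorted blocks\<close>

lemma max_split_induct [consumes 1, case_names Nil split]:
  fixes w :: "nat list"
  assumes "distinct w" and "P []"
    and split: "\<And>L m R. distinct (L @ m # R) \<Longrightarrow> (\<And>x. x \<in> set L \<Longrightarrow> x < m) \<Longrightarrow>
      (\<And>x. x \<in> set R \<Longrightarrow> x < m) \<Longrightarrow> P L \<Longrightarrow> P R \<Longrightarrow> P (L @ m # R)"
  shows "P w"
  using assms(1)
proof (induction w rule: length_induct)
  case (1 w)
  show ?case
  proof (cases "w = []")
    case False
    define m where "m = Max (set w)"
    have "m \<in> set w" using False by (simp add: m_def)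
    then obtain L R where w: "w = L @ m # R" by (meson split_list)
    have le: "x \<le> m" if "x \<in> set w" for x using that by (simp add: m_def)
    have "x < m" if "x \<in> set L \<union> set R" for x
      using le[of x] 1(2) that unfolding w by (cases "x = m") auto
    then show ?thesis unfolding w
      using 1 by (intro split) (auto simp: w)
  qed (use assms in simp)
qed

lemma max_split_cases [consumes 1, case_names Nil split]:
  fixes w :: "nat list"
  assumes "distinct w"
  obtains "w = []"
  | L m R where "w = L @ m # R" "\<And>x. x \<in> set L \<Longrightarrow> x < m" "\<And>x. x \<in> set R \<Longrightarrow> x < m"
proof -
  have "w = [] \<or> (\<exists>L m R. w = L @ m # R \<and> (\<forall>x\<in>set L. x < m) \<and> (\<forall>x\<in>set R. x < m))"
    using assms by (induction rule: max_split_induct) blast+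
  then show ?thesis using that by blast
qed

function blocks :: "nat list \<Rightarrow> nat" where
  "blocks w =
    (if w = [] then 0
     else let m = Max (set w);
              L = takeWhile (\<lambda>x. x \<noteq> m) w;
              R = tl (dropWhile (\<lambda>x. x \<noteq> m) w)
          in (blocks L - 2) + 1 + blocks R)"
  by pat_completeness auto
termination
proof (relation "Wellfounded.measure length", goal_cases)
  case (2 w m L R)
  have "m \<in> set w" using 2(1,2) by simp
  then have "length (takeWhile (\<lambda>x. x \<noteq> m) w) < length w"
    by (induction w) auto
  then show ?case using 2(3) by simp
next
  case (3 w m L R)
  have "length R \<le> length w - 1"
    using 3(4) length_dropWhile_le[of "\<lambda>x. x \<noteq> m" w] by simp
  with 3(1) show ?case by (cases w) auto
qed simp

declare blocks.simps [simp del]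

lemma blocks_Nil [simp]: "blocks [] = 0"
  by (simp add: blocks.simps)

lemma blocks_split:
  assumes "\<And>x. x \<in> set L \<Longrightarrow> x < m" and "\<And>x. x \<in> set R \<Longrightarrow> x < m"
  shows "blocks (L @ m # R) = (blocks L - 2) + 1 + blocks R"
proof -
  have "Max (set (L @ m # R)) = m"
    by (rule Max_eqI) (use assms in \<open>auto intro: less_imp_le\<close>)
  moreover have "takeWhile (\<lambda>x. x \<noteq> m) (L @ m # R) = L"
    using assms(1) by (subst takeWhile_append2) auto
  moreover have "dropWhile (\<lambda>x. x \<noteq> m) (L @ m # R) = m # R"
    using assms(1) by (subst dropWhile_append2) auto
  ultimately show ?thesis
    by (subst blocks.simps) (simp add: Let_def)
qed

lemma blocks_eq_0_iff:
  assumes "distinct w"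
  shows "blocks w = 0 \<longleftrightarrow> w = []"
  using assms by (induction rule: max_split_induct) (auto simp: blocks_split)

text \<open>
Cutting a list at one more place cannot help. The maximum lies in one of the two parts, and the
truncated subtraction satisfies \<open>(a + b) - 2 \<le> a + (b - 2)\<close>, so the recursion passes the bound from
the shorter lists on.
\<close>

lemma blocks_append_le:
  assumes "distinct (u @ v)"
  shows "blocks (u @ v) \<le> blocks u + blocks v"
proof -
  have "\<forall>u v. w = u @ v \<longrightarrow> blocks w \<le> blocks u + blocks v" if "distinct w" for w
    using that
  proof (induction rule: max_split_induct)
    case (split L m R)
    show ?case
    proof (intro allI impI)
      fix u v assume uv: "L @ m # R = u @ v"
      then consider (left) R' where "u = L @ m # R'" "R = R' @ v"
        | (right) L' where "v = L' @ m # R" "L = u @ L'"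
      proof -
        from uv[unfolded append_eq_append_conv2] obtain us where
          "L = u @ us \<and> us @ m # R = v \<or> L @ us = u \<and> m # R = us @ v"
          by blast
        then show thesis
          using left right[of us] right[of "[]"] by (cases us) auto
      qed
      then show "blocks (L @ m # R) \<le> blocks u + blocks v"
      proof cases
        case left
        then have "blocks u = (blocks L - 2) + 1 + blocks R'"
          unfolding left using split left by (intro blocks_split) auto
        moreover have "blocks R \<le> blocks R' + blocks v" using split(5) left by blast
        moreover have "blocks (L @ m # R) = (blocks L - 2) + 1 + blocks R"
          using split by (intro blocks_split) auto
        ultimately show ?thesis by linarith
      next
        case right
        then have "blocks v = (blocks L' - 2) + 1 + blocks R"
          unfolding right using split right by (intro blocks_split) auto
        moreover have "blocks L \<le> blocks u + blocks L'" using split(4) right by blast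
        moreover have "blocks (L @ m # R) = (blocks L - 2) + 1 + blocks R"
          using split by (intro blocks_split) auto
        ultimately show ?thesis by linarith
      qed
    qed
  qed simp
  with assms show ?thesis by blast
qed

text \<open>
Conversely a list can be cut so that the numbers of blocks add up. If the first \<open>j\<close> blocks end
before those that the maximum absorbs, the cut is made to the left of the maximum, otherwise to its
right.
\<close>

lemma blocks_split_at:
  assumes "distinct w" "j \<le> blocks w"
  obtains u v where "w = u @ v" "blocks u = j" "blocks v = blocks w - j"
proof -
  have "\<forall>j \<le> blocks w. \<exists>u v. w = u @ v \<and> blocks u = j \<and> blocks v = blocks w - j"
    using assms(1)
  proof (induction rule: max_split_induct)
    case (split L m R)
    have whole: "blocks (L @ m # R) = (blocks L - 2) + 1 + blocks R"
      using split by (intro blocks_split) auto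
    show ?case
    proof (intro allI impI)
      fix j assume j: "j \<le> blocks (L @ m # R)"
      show "\<exists>u v. L @ m # R = u @ v \<and> blocks u = j \<and> blocks v = blocks (L @ m # R) - j"
      proof (cases "j \<le> blocks L - 2")
        case True
        then have "j \<le> blocks L" by simp
        with split(4) obtain u v where uv: "L = u @ v" "blocks u = j" "blocks v = blocks L - j"
          by blast
        have "blocks (v @ m # R) = (blocks v - 2) + 1 + blocks R"
          using split uv by (intro blocks_split) auto
        then have "blocks (v @ m # R) = blocks (L @ m # R) - j"
          using True uv(3) whole by simp
        with uv show ?thesis by (intro exI[of _ u] exI[of _ "v @ m # R"]) simp
      next
        case False
        define i where "i = j - ((blocks L - 2) + 1)"
        have "i \<le> blocks R" using j whole by (simp add: i_def)
        with split(5) obtain u v where uv: "R = u @ v" "blocks u = i" "blocks v = blocks R - i"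
          by blast
        have "blocks (L @ m # u) = (blocks L - 2) + 1 + blocks u"
          using split uv by (intro blocks_split) auto
        then have "blocks (L @ m # u) = j" using False uv(2) by (simp add: i_def)
        moreover have "blocks v = blocks (L @ m # R) - j"
          using False j whole uv(3) by (simp add: i_def)
        ultimately show ?thesis using uv by (intro exI[of _ "L @ m # u"] exI[of _ v]) simp
      qed
    qed
  qed simp
  with assms that show ?thesis by blast
qed

lemma stack_sort_set_distinct:
  assumes "distinct w"
  shows "set (stack_sort w) = set w \<and> distinct (stack_sort w)"
  using assms
  by (induction rule: max_split_induct) (auto simp: stack_sort_split)

lemma blocks_stack_sort_le:
  assumes "distinct w"
  shows "blocks (stack_sort w) \<le> 1"
  using assms
proof (induction rule: max_split_induct)
  case (split L m R)
  let ?L = "stack_sort L" and ?R = "stack_sort R"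
  have LR: "set ?L = set L" "set ?R = set R" "distinct ?L" "distinct ?R"
    using stack_sort_set_distinct split(1) by auto
  have "blocks (?L @ ?R) \<le> 2"
    using blocks_append_le[of ?L ?R] LR split by auto
  moreover have "blocks ((?L @ ?R) @ m # []) = (blocks (?L @ ?R) - 2) + 1 + blocks []"
    using LR split by (intro blocks_split) auto
  ultimately show ?case using split by (simp add: stack_sort_split)
qed simp

text \<open>
A list with one block ends with its maximum \<open>m\<close>, and the part before \<open>m\<close> has at most two blocks. It
can therefore be cut into two lists with at most one block each, whose preimages, put around \<open>m\<close>,
form a preimage of the whole list.
\<close>

lemma stack_sort_preimage:
  assumes "distinct w" "blocks w \<le> 1"
  shows "\<exists>v. distinct v \<and> set v = set w \<and> stack_sort v = w"
  using assms
proof (induction w rule: length_induct)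
  case (1 w)
  from 1(2) show ?case
  proof (cases rule: max_split_cases)
    case (split L m R)
    have "(blocks L - 2) + 1 + blocks R \<le> 1"
      using 1(3) blocks_split[of L m R] split by simp
    then have "blocks R = 0" and L2: "blocks L \<le> 2" by auto
    then have R: "R = []" using 1(2) split(1) blocks_eq_0_iff by auto
    have dL: "distinct L" using 1(2) split(1) by simp
    obtain x y where "L = x @ y" "blocks x = min 1 (blocks L)" "blocks y = blocks L - min 1 (blocks L)"
      using blocks_split_at[OF dL, of "min 1 (blocks L)"] by (metis min.cobounded2)
    then have xy: "L = x @ y" "blocks x \<le> 1" "blocks y \<le> 1"
      using L2 by linarith+
    obtain x' where x': "distinct x'" "set x' = set x" "stack_sort x' = x"
      using 1(1)[rule_format, of x] xy dL split by auto
    obtain y' where y': "distinct y'" "set y' = set y" "stack_sort y' = y"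
      using 1(1)[rule_format, of y] xy dL split by auto
    have "stack_sort (x' @ m # y') = w"
      using x' y' xy R split by (subst stack_sort_split) auto
    moreover have "distinct (x' @ m # y')" "set (x' @ m # y') = set w"
      using x' y' xy(1) R split(1) 1(2) by (simp_all add: insert_commute)
    ultimately show ?thesis by blast
  qed (auto intro: exI[of _ "[]"])
qed

lemma stack_sort_image_eq:
  "stack_sort ` permutations_of_set X = {w \<in> permutations_of_set X. blocks w \<le> 1}"
proof (intro equalityI subsetI)
  fix w assume "w \<in> stack_sort ` permutations_of_set X"
  then obtain v where "v \<in> permutations_of_set X" "w = stack_sort v" by auto
  then show "w \<in> {w \<in> permutations_of_set X. blocks w \<le> 1}"
    using stack_sort_set_distinct[of v] blocks_stack_sort_le[of v]
    by (auto simp: permutations_of_set_def)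
next
  fix w assume w: "w \<in> {w \<in> permutations_of_set X. blocks w \<le> 1}"
  then obtain v where "distinct v" "set v = set w" "stack_sort v = w"
    using stack_sort_preimage[of w] by (auto simp: permutations_of_set_def)
  with w show "w \<in> stack_sort ` permutations_of_set X"
    by (auto simp: permutations_of_set_def image_iff intro!: exI[of _ v])
qed

section \<open>Counting permutations by their number of blocks\<close>

definition block_perms :: "nat \<Rightarrow> nat set \<Rightarrow> nat list set" where
  "block_perms k X = {w \<in> permutations_of_set X. blocks w = k}"

definition block_count :: "nat \<Rightarrow> nat \<Rightarrow> nat" where
  "block_count k n = card (block_perms k {..<n})"

lemma finite_block_perms [simp]: "finite X \<Longrightarrow> finite (block_perms k X)"
  by (simp add: block_perms_def)

text \<open>
Only the relative order of the entries matters, so the number of lists with \<open>k\<close> blocks on a set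
depends only on the size of the set.
\<close>

lemma blocks_map:
  assumes "distinct w" "strict_mono_on (set w) f"
  shows "blocks (map f w) = blocks w"
  using assms
proof (induction rule: max_split_induct)
  case (split L m R)
  have mono: "strict_mono_on (set L) f" "strict_mono_on (set R) f"
    using split(6) by (auto intro: monotone_on_subset)
  have "f x < f m" if "x \<in> set L \<union> set R" for x
    using split that by (auto simp: strict_mono_on_def)
  then have "blocks (map f L @ f m # map f R) = (blocks (map f L) - 2) + 1 + blocks (map f R)"
    by (intro blocks_split) auto
  with split mono show ?case by (simp add: blocks_split)
qed simp

lemma card_block_perms:
  assumes "finite X"
  shows "card (block_perms k X) = block_count k (card X)"
proof -
  obtain h where h: "bij_betw h {..<card X} X" "strict_mono_on {..<card X} h"
    using ex_bij_betw_strict_mono_card[OF assms] by blast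
  have inj: "inj_on h {..<card X}" and im: "h ` {..<card X} = X"
    using bij_betw_imp_inj_on[OF h(1)] bij_betw_imp_surj_on[OF h(1)] .
  have "block_perms k X = map h ` block_perms k {..<card X}"
  proof -
    have "permutations_of_set X = map h ` permutations_of_set {..<card X}"
      using permutations_of_set_image_inj[OF inj] unfolding im .
    moreover have "blocks (map h w) = blocks w" if "w \<in> permutations_of_set {..<card X}" for w
      using that h(2)
      by (intro blocks_map) (auto dest: permutations_of_setD)
    ultimately show ?thesis by (auto simp: block_perms_def)
  qed
  moreover have "inj_on (map h) (block_perms k {..<card X})"
  proof (rule inj_on_mapI, rule inj_on_subset[OF inj])
    show "\<Union> (set ` block_perms k {..<card X}) \<subseteq> {..<card X}"
      by (auto simp: block_perms_def permutations_of_set_def)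
  qed
  ultimately show ?thesis by (simp add: block_count_def card_image)
qed

lemma sum_Pow_card:
  fixes F :: "nat \<Rightarrow> nat"
  assumes "finite Y"
  shows "(\<Sum>A\<in>Pow Y. F (card A)) = (\<Sum>i\<le>card Y. (card Y choose i) * F i)"
proof -
  have "(\<Sum>A\<in>Pow Y. F (card A))
      = (\<Sum>i\<le>card Y. \<Sum>A\<in>{A \<in> Pow Y. card A = i}. F (card A))"
    using assms by (intro sum.group[symmetric]) (auto intro: card_mono)
  also have "\<dots> = (\<Sum>i\<le>card Y. (card Y choose i) * F i)"
    using n_subsets[OF assms] by (intro sum.cong) auto
  finally show ?thesis .
qed

text \<open>
A permutation of \<open>{..<Suc n}\<close> is given by the set of entries before the maximum and the arrangements
on its two sides. The index set \<open>I\<close> lists the pairs of block numbers of the two sides that lead to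
\<open>k\<close> blocks; leaving it abstract lets each small \<open>k\<close> be instantiated with an explicit list of pairs.
\<close>

lemma block_count_Suc:
  assumes "finite I" "\<And>a b. (a, b) \<in> I \<longleftrightarrow> (a - 2) + 1 + b = k"
  shows "block_count k (Suc n)
    = (\<Sum>i\<le>n. (n choose i) * (\<Sum>(a, b)\<in>I. block_count a i * block_count b (n - i)))"
proof -
  define T where "T = (SIGMA A:Pow {..<n}. \<Union>(a, b)\<in>I. block_perms a A \<times> block_perms b ({..<n} - A))"
  define f :: "nat set \<times> nat list \<times> nat list \<Rightarrow> nat list"
    where "f = (\<lambda>(A, L, R). L @ n # R)"
  have inT: "(A, L, R) \<in> T \<longleftrightarrow> A \<subseteq> {..<n} \<and> set L = A \<and> distinct L \<and> set R = {..<n} - A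
      \<and> distinct R \<and> (blocks L - 2) + 1 + blocks R = k" for A L R
    unfolding T_def using assms(2) by (auto simp: block_perms_def permutations_of_set_def)
  have bij: "bij_betw f T (block_perms k {..<Suc n})"
    unfolding bij_betw_def
  proof
    show "inj_on f T"
    proof (rule inj_onI)
      fix x y assume xy: "x \<in> T" "y \<in> T" "f x = f y"
      obtain A L R A' L' R' where xy_eq: "x = (A, L, R)" "y = (A', L', R')"
        by (metis prod_cases3)
      note * = xy[unfolded xy_eq]
      have "n \<notin> set L" "n \<notin> set R" using * by (auto simp: inT)
      with *(3) have "L = L' \<and> R = R'"
        by (simp add: f_def append_Cons_eq_iff)
      with * show "x = y" by (auto simp: inT xy_eq)
    qed
    show "f ` T = block_perms k {..<Suc n}"
    proof (intro equalityI subsetI)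
      fix w assume "w \<in> f ` T"
      then obtain A L R where *: "(A, L, R) \<in> T" "w = L @ n # R" by (auto simp: f_def)
      then have "blocks w = (blocks L - 2) + 1 + blocks R"
        unfolding *(2) by (intro blocks_split) (auto simp: inT)
      with * show "w \<in> block_perms k {..<Suc n}"
        by (auto simp: inT block_perms_def permutations_of_set_def)
    next
      fix w assume "w \<in> block_perms k {..<Suc n}"
      then have w: "set w = {..<Suc n}" "distinct w" "blocks w = k"
        by (auto simp: block_perms_def permutations_of_set_def)
      then obtain L R where LR: "w = L @ n # R" by (metis lessThan_iff lessI split_list)
      have lt: "x < n" if "x \<in> set L \<union> set R" for x
      proof -
        have "x \<in> {..<Suc n}" "x \<noteq> n" using that w unfolding LR by auto
        then show ?thesis by simp
      qed
      then have "blocks w = (blocks L - 2) + 1 + blocks R"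
        unfolding LR by (intro blocks_split) auto
      moreover have "set R = {..<n} - set L"
      proof -
        have "set L \<union> set R = {..<n}"
        proof (intro equalityI subsetI)
          fix x assume "x \<in> {..<n}"
          then have "x \<in> set w" "x \<noteq> n" using w by auto
          then show "x \<in> set L \<union> set R" using LR by auto
        qed (use lt in auto)
        then show ?thesis using w(2) LR by auto
      qed
      ultimately have "(set L, L, R) \<in> T" using w lt by (auto simp: inT LR)
      then show "w \<in> f ` T" by (force simp: f_def LR)
    qed
  qed
  have cardA: "card (\<Union>(a, b)\<in>I. block_perms a A \<times> block_perms b ({..<n} - A))
      = (\<Sum>(a, b)\<in>I. block_count a (card A) * block_count b (n - card A))"
    if "A \<subseteq> {..<n}" for A
  proof -
    have fin: "finite A" using that finite_subset by blast
    have "card (\<Union>(a, b)\<in>I. block_perms a A \<times> block_perms b ({..<n} - A))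
        = (\<Sum>(a, b)\<in>I. card (block_perms a A \<times> block_perms b ({..<n} - A)))"
      using assms(1) fin by (subst card_UN_disjoint)
        (auto simp: block_perms_def case_prod_unfold)
    also have "\<dots> = (\<Sum>(a, b)\<in>I. block_count a (card A) * block_count b (n - card A))"
      using fin that by (simp add: card_cartesian_product card_block_perms card_Diff_subset)
    finally show ?thesis .
  qed
  have "block_count k (Suc n) = card T"
    using bij_betw_same_card[OF bij] by (simp add: block_count_def)
  also have "\<dots> = (\<Sum>A\<in>Pow {..<n}. card (\<Union>(a, b)\<in>I. block_perms a A \<times> block_perms b ({..<n} - A)))"
    unfolding T_def by (rule card_SigmaI) (use assms(1) in \<open>auto intro!: finite_cartesian_product finite_block_perms
        intro: finite_subset\<close>)
  also have "\<dots> = (\<Sum>A\<in>Pow {..<n}. \<Sum>(a, b)\<in>I. block_count a (card A) * block_count b (n - card A))"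
    using cardA by (intro sum.cong) auto
  also have "\<dots> = (\<Sum>i\<le>n. (n choose i) * (\<Sum>(a, b)\<in>I. block_count a i * block_count b (n - i)))"
    using sum_Pow_card[of "{..<n}" "\<lambda>i. \<Sum>(a, b)\<in>I. block_count a i * block_count b (n - i)"] by simp
  finally show ?thesis .
qed

text \<open>
Every permutation with \<open>j + k\<close> blocks arises by concatenating one with \<open>j\<close> and one with \<open>k\<close> blocks
on complementary sets of entries. The converse fails, since adjacent blocks may merge.
\<close>

lemma block_count_add_le:
  "block_count (j + k) n \<le> (\<Sum>i\<le>n. (n choose i) * (block_count j i * block_count k (n - i)))"
proof -
  define f :: "nat list \<times> nat list \<Rightarrow> nat list" where "f = (\<lambda>(u, v). u @ v)"
  have "block_perms (j + k) {..<n}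
      \<subseteq> (\<Union>A\<in>Pow {..<n}. f ` (block_perms j A \<times> block_perms k ({..<n} - A)))"
  proof
    fix w assume "w \<in> block_perms (j + k) {..<n}"
    then have w: "set w = {..<n}" "distinct w" "blocks w = j + k"
      by (auto simp: block_perms_def permutations_of_set_def)
    then obtain u v where uv: "w = u @ v" "blocks u = j" "blocks v = k"
      using blocks_split_at[of w j] by (metis add_diff_cancel_left' le_add1)
    then have "(u, v) \<in> block_perms j (set u) \<times> block_perms k ({..<n} - set u)" "set u \<in> Pow {..<n}"
      using w by (auto simp: block_perms_def permutations_of_set_def)
    then show "w \<in> (\<Union>A\<in>Pow {..<n}. f ` (block_perms j A \<times> block_perms k ({..<n} - A)))"
      using uv by (force simp: f_def)
  qed
  then have "block_count (j + k) n
      \<le> card (\<Union>A\<in>Pow {..<n}. f ` (block_perms j A \<times> block_perms k ({..<n} - A)))"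
    unfolding block_count_def
    by (intro card_mono finite_UN_I finite_imageI finite_cartesian_product finite_block_perms)
      (auto intro: finite_subset)
  also have "\<dots> \<le> (\<Sum>A\<in>Pow {..<n}. card (f ` (block_perms j A \<times> block_perms k ({..<n} - A))))"
    by (rule card_UN_le) simp
  also have "\<dots> \<le> (\<Sum>A\<in>Pow {..<n}. block_count j (card A) * block_count k (n - card A))"
  proof (rule sum_mono)
    fix A assume "A \<in> Pow {..<n}"
    then have A: "A \<subseteq> {..<n}" "finite A" by (auto intro: finite_subset)
    have "card (f ` (block_perms j A \<times> block_perms k ({..<n} - A)))
        \<le> card (block_perms j A \<times> block_perms k ({..<n} - A))"
      using A by (intro card_image_le) simp
    also have "\<dots> = block_count j (card A) * block_count k (n - card A)"
      using A by (simp add: card_cartesian_product card_block_perms card_Diff_subset)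
    finally show "card (f ` (block_perms j A \<times> block_perms k ({..<n} - A)))
        \<le> block_count j (card A) * block_count k (n - card A)" .
  qed
  also have "\<dots> = (\<Sum>i\<le>n. (n choose i) * (block_count j i * block_count k (n - i)))"
    using sum_Pow_card[of "{..<n}" "\<lambda>i. block_count j i * block_count k (n - i)"] by simp
  finally show ?thesis .
qed


section \<open>The system of recurrences\<close>

text \<open>
The Cauchy product.
\<close>

definition conv :: "(nat \<Rightarrow> real) \<Rightarrow> (nat \<Rightarrow> real) \<Rightarrow> nat \<Rightarrow> real" where
  "conv f g n = (\<Sum>i\<le>n. f i * g (n - i))"

lemma conv_commute: "conv f g n = conv g f n"
  unfolding conv_def
  by (rule sum.reindex_bij_witness[of _ "\<lambda>i. n - i" "\<lambda>i. n - i"]) (auto simp: mult.commute)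

lemma conv_mono:
  assumes "\<And>i. i \<le> n \<Longrightarrow> 0 \<le> f i" "\<And>i. i \<le> n \<Longrightarrow> f i \<le> f' i"
    and "\<And>i. i \<le> n \<Longrightarrow> 0 \<le> g i" "\<And>i. i \<le> n \<Longrightarrow> g i \<le> g' i"
  shows "conv f g n \<le> conv f' g' n"
  unfolding conv_def
proof (rule sum_mono)
  fix i assume "i \<in> {..n}"
  then show "f i * g (n - i) \<le> f' i * g' (n - i)"
    using assms(1)[of i] assms(2)[of i] assms(3)[of "n - i"] assms(4)[of "n - i"]
    by (intro mult_mono) auto
qed

definition block_density :: "nat \<Rightarrow> nat \<Rightarrow> real" where
  "block_density k n = real (block_count k n) / fact n"

lemma block_density_nonneg [simp]: "0 \<le> block_density k n"
  by (simp add: block_density_def)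

lemma sum_choose_eq_conv:
  "(\<Sum>i\<le>n. real (n choose i) * (real (block_count a i) * real (block_count b (n - i)))) / fact n
    = conv (block_density a) (block_density b) n"
  unfolding conv_def sum_divide_distrib
  by (intro sum.cong) (simp_all add: block_density_def binomial_fact field_simps)

text \<open>
Dividing by \<open>n!\<close> turns the binomial convolution into the Cauchy product; the factor \<open>Suc n\<close> on the
left makes the left-hand side the coefficient of a derivative.
\<close>

lemma block_density_Suc:
  assumes "finite I" "\<And>a b. (a, b) \<in> I \<longleftrightarrow> (a - 2) + 1 + b = k"
  shows "real (Suc n) * block_density k (Suc n)
    = (\<Sum>(a, b)\<in>I. conv (block_density a) (block_density b) n)"
proof -
  have "real (Suc n) * block_density k (Suc n) = real (block_count k (Suc n)) / fact n"
    unfolding block_density_def fact_Suc of_nat_mult of_nat_fact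
    by (simp del: of_nat_Suc)
  also have "real (block_count k (Suc n)) = (\<Sum>i\<le>n. \<Sum>(a, b)\<in>I.
      real (n choose i) * (real (block_count a i) * real (block_count b (n - i))))"
    by (simp add: block_count_Suc[OF assms] sum_distrib_left case_prod_unfold)
  also have "\<dots> = (\<Sum>(a, b)\<in>I. \<Sum>i\<le>n.
      real (n choose i) * (real (block_count a i) * real (block_count b (n - i))))"
    unfolding case_prod_unfold by (rule sum.swap)
  also have "\<dots> / fact n = (\<Sum>(a, b)\<in>I. conv (block_density a) (block_density b) n)"
    unfolding sum_divide_distrib case_prod_unfold sum_choose_eq_conv[symmetric] ..
  finally show ?thesis .
qed

lemma block_density_add_le:
  "block_density (j + k) n \<le> conv (block_density j) (block_density k) n"
proof -
  have "real (block_count (j + k) n)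
      \<le> (\<Sum>i\<le>n. real (n choose i) * (real (block_count j i) * real (block_count k (n - i))))"
    using of_nat_mono[OF block_count_add_le[of j k n], where ?'a = real] by simp
  then show ?thesis
    unfolding sum_choose_eq_conv[symmetric] block_density_def by (rule divide_right_mono) simp
qed

definition \<delta> :: "nat \<Rightarrow> real" where "\<delta> n = (if n = 0 then 1 else 0)"

lemma block_density_0: "block_density 0 = \<delta>"
proof
  fix n
  show "block_density 0 n = \<delta> n"
  proof (cases "n = 0")
    case True
    then have "block_perms 0 {..<n} = {[]}"
      by (simp add: block_perms_def Collect_conv_if conj_commute)
    with True show ?thesis by (simp add: block_density_def block_count_def \<delta>_def)
  next
    case False
    have "w \<notin> block_perms 0 {..<n}" for w
    proof
      assume "w \<in> block_perms 0 {..<n}"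
      then have "set w = {..<n}" "distinct w" "blocks w = 0"
        by (simp_all add: block_perms_def permutations_of_set_def)
      with False show False using blocks_eq_0_iff[of w] by auto
    qed
    then have "block_perms 0 {..<n} = {}" by blast
    with False show ?thesis by (simp add: block_density_def block_count_def \<delta>_def)
  qed
qed

lemma block_density_0_right: "0 < k \<Longrightarrow> block_density k 0 = 0"
  by (auto simp: block_density_def block_count_def block_perms_def)

lemma conv_\<delta>: "conv f \<delta> n = f n"
proof -
  have "conv f \<delta> n = (\<Sum>i\<le>n. if i = n then f i else 0)"
    unfolding conv_def by (intro sum.cong) (auto simp: \<delta>_def)
  then show ?thesis by simp
qed

lemma conv_add_right: "conv h (\<lambda>i. f i + g i) n = conv h f n + conv h g n"
  by (simp add: conv_def distrib_left sum.distrib)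

abbreviation at_most_two_blocks :: "nat \<Rightarrow> real" where
  "at_most_two_blocks \<equiv> \<lambda>n. \<delta> n + block_density 1 n + block_density 2 n"

text \<open>
The four recurrences are the coefficient forms of $p' = 1 + p + q$, $q' = p p' + r$,
$r' = q p' + p r + s$ and $s' \ge r p' + q r + p s$. They group the terms of \<open>block_density_Suc\<close> in
which the list before the maximum is completely absorbed into the factor $p'$.
\<close>

lemma block_density_1_Suc: "real (Suc n) * block_density 1 (Suc n) = at_most_two_blocks n"
proof -
  have "(a, b) \<in> {(0, 0), (1, 0), (2, 0)} \<longleftrightarrow> (a - 2) + 1 + b = 1" for a b :: nat
    by (simp, presburger)
  from block_density_Suc[OF _ this] show ?thesis
    by (simp add: block_density_0 conv_\<delta>)
qed

lemma block_density_2_Suc: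
  "real (Suc n) * block_density 2 (Suc n)
    = conv (block_density 1) at_most_two_blocks n + block_density 3 n"
proof -
  have "(a, b) \<in> {(0, 1), (1, 1), (2, 1), (3, 0)} \<longleftrightarrow> (a - 2) + 1 + b = 2" for a b :: nat
    by (simp, presburger)
  from block_density_Suc[OF _ this] show ?thesis
    by (simp add: block_density_0 conv_\<delta> conv_add_right
        conv_commute[of \<delta> "block_density 1"] conv_commute[of "block_density 2" "block_density 1"]
        del: One_nat_def)
qed

lemma block_density_3_Suc:
  "real (Suc n) * block_density 3 (Suc n)
    = conv (block_density 2) at_most_two_blocks n + conv (block_density 1) (block_density 3) n
      + block_density 4 n"
proof -
  have "(a, b) \<in> {(0, 2), (1, 2), (2, 2), (3, 1), (4, 0)} \<longleftrightarrow> (a - 2) + 1 + b = 3" for a b :: nat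
    by (simp, presburger)
  from block_density_Suc[OF _ this] show ?thesis
    by (simp add: block_density_0 conv_\<delta> conv_add_right
        conv_commute[of "block_density 3" "block_density 1"]
        conv_commute[of \<delta> "block_density 2"] conv_commute[of "block_density 1" "block_density 2"]
        del: One_nat_def)
qed

lemma block_density_4_Suc:
  "conv (block_density 3) at_most_two_blocks n + conv (block_density 2) (block_density 3) n
      + conv (block_density 1) (block_density 4) n
    \<le> real (Suc n) * block_density 4 (Suc n)"
proof -
  have "(a, b) \<in> {(0, 3), (1, 3), (2, 3), (3, 2), (4, 1), (5, 0)} \<longleftrightarrow> (a - 2) + 1 + b = 4"
    for a b :: nat
    by (simp, presburger)
  from block_density_Suc[OF _ this] show ?thesis
    by (simp add: block_density_0 conv_\<delta> conv_add_right
        conv_commute[of "block_density 4" "block_density 1"]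
        conv_commute[of \<delta> "block_density 3"] conv_commute[of "block_density 1" "block_density 3"]
        conv_commute[of "block_density 2" "block_density 3"]
        del: One_nat_def)
qed

lemma card_stack_sort_image:
  "real (card (stack_sort ` S n)) / fact n = \<delta> n + block_density 1 n"
proof -
  have "stack_sort ` S n = block_perms 0 {1..n} \<union> block_perms 1 {1..n}"
    unfolding S_def stack_sort_image_eq block_perms_def by auto
  also have "card \<dots> = card (block_perms 0 {1..n}) + card (block_perms 1 {1..n})"
    by (intro card_Un_disjoint) (auto simp: block_perms_def)
  finally show ?thesis
    by (simp add: card_block_perms block_density_def add_divide_distrib flip: block_density_0)
qed

section \<open>Existence of the limit\<close>

text \<open>
Fekete's lemma with a logarithmic error. Replacing \<open>b n\<close> by \<open>v n = b n + ln (9 n)\<close> makes the sequence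
subadditive for balanced pairs, those with \<open>k \<le> 2 l\<close> and \<open>l \<le> 2 k\<close>: there the gain
\<open>ln (9 k) + ln (9 l) - ln (9 (k + l))\<close> pays for \<open>ln (2 (k + l))\<close>, because \<open>2 (k + l)\<^sup>2 \<le> 9 k l\<close> is
equivalent to \<open>(2 k - l) (2 l - k) \<ge> 0\<close>. Halving \<open>m\<close> repeatedly uses only balanced pairs and gives
\<open>v (m k) \<le> m v k\<close>, after which the limit is the infimum of \<open>v k / k\<close> as in Fekete's proof.
\<close>

lemma subadditive_log_error_convergent:
  fixes b :: "nat \<Rightarrow> real"
  assumes nonneg: "\<And>n. 1 \<le> n \<Longrightarrow> 0 \<le> b n"
    and sub: "\<And>k l. 1 \<le> k \<Longrightarrow> 1 \<le> l \<Longrightarrow> b (k + l) \<le> b k + b l + ln (2 * real (k + l))"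
  shows "\<exists>\<theta>. (\<lambda>n. b n / real n) \<longlonglongrightarrow> \<theta>"
proof -
  define v where "v n = b n + ln (9 * real n)" for n
  have v_add: "v (k + l) \<le> v k + v l" if "1 \<le> k" "1 \<le> l" "k \<le> 2 * l" "l \<le> 2 * k" for k l
  proof -
    have "0 \<le> (2 * real k - real l) * (2 * real l - real k)"
      using that(3,4) by (intro mult_nonneg_nonneg) linarith+
    then have "18 * (real k + real l)\<^sup>2 \<le> 81 * (real k * real l)"
      by (simp add: power2_eq_square algebra_simps)
    then have "ln (18 * (real k + real l)\<^sup>2) \<le> ln (81 * (real k * real l))"
      using that by (subst ln_le_cancel_iff) auto
    moreover have "ln (18 * (real k + real l)\<^sup>2) = ln (2 * real (k + l)) + ln (9 * real (k + l))"
      using that by (subst ln_mult_pos[symmetric]) (auto simp: power2_eq_square algebra_simps)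
    moreover have "ln (81 * (real k * real l)) = ln (9 * real k) + ln (9 * real l)"
      using that by (subst ln_mult_pos[symmetric]) (auto simp: algebra_simps)
    ultimately show ?thesis using sub[OF that(1,2)] by (simp add: v_def)
  qed
  have v_mult: "v (m * k) \<le> real m * v k" if "1 \<le> m" "1 \<le> k" for m k
    using that(1)
  proof (induction m rule: less_induct)
    case (less m)
    show ?case
    proof (cases "m = 1")
      case False
      define a c where "a = m div 2" and "c = m - m div 2"
      have ac: "m = a + c" "1 \<le> a" "1 \<le> c" "a < m" "c < m" "a \<le> 2 * c" "c \<le> 2 * a"
        using False less.prems by (auto simp: a_def c_def)
      have "v (a * k + c * k) \<le> v (a * k) + v (c * k)"
        using ac that(2) mult_le_mono1[OF ac(6), of k] mult_le_mono1[OF ac(7), of k]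
        by (intro v_add) (auto simp: mult.assoc)
      also have "\<dots> \<le> real a * v k + real c * v k"
        using ac by (intro add_mono less.IH)
      finally show ?thesis by (simp add: ac(1) algebra_simps)
    qed simp
  qed
  have ln9: "0 \<le> ln (9 * real n)" if "1 \<le> n" for n
    using that by (intro ln_ge_zero) auto
  have v_nonneg: "0 \<le> v n" if "1 \<le> n" for n
    using nonneg[OF that] ln9[OF that] by (simp add: v_def)
  define V where "V = (\<lambda>k. v k / real k) ` {1..}"
  define \<theta> where "\<theta> = Inf V"
  have bdd: "bdd_below V"
    unfolding V_def by (rule bdd_belowI2[where m = 0]) (auto intro!: divide_nonneg_nonneg v_nonneg)
  have lower: "\<theta> - ln (9 * real n) / real n \<le> b n / real n" if "1 \<le> n" for n
  proof -
    have "\<theta> \<le> v n / real n"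
      unfolding \<theta>_def using that by (intro cInf_lower bdd) (auto simp: V_def)
    then show ?thesis by (simp add: v_def add_divide_distrib)
  qed
  have upper: "\<forall>\<^sub>F n in sequentially. b n / real n < \<theta> + e" if "0 < e" for e
  proof -
    have "Inf V < \<theta> + e / 2" using that by (simp add: \<theta>_def)
    then obtain y where "y \<in> V" "y < \<theta> + e / 2"
      by (metis V_def atLeast_iff cInf_lessD empty_iff image_is_empty order_refl)
    then obtain k where k: "1 \<le> k" "v k / real k < \<theta> + e / 2" by (auto simp: V_def)
    define B where "B = Max (b ` {1..k})"
    have bound: "b n / real n \<le> v k / real k + (B + ln (2 * real n)) / real n" if n: "k < n" for n
    proof -
      \<comment> \<open>The remainder is taken in \<open>{1..k}\<close>, because nothing is known about \<open>b 0\<close>.\<close>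
      define m where "m = (n - 1) div k"
      define t where "t = n - m * k"
      have "m * k \<le> n - 1" "n - 1 < (m + 1) * k"
        using k(1) dividend_less_div_times[of k "n - 1"] by (simp_all add: m_def)
      then have t: "n = m * k + t" "1 \<le> t" "t \<le> k"
        using n by (auto simp: t_def)
      have m: "1 \<le> m" using n k(1) by (simp add: m_def div_greater_zero_iff Suc_le_eq)
      have mk: "1 \<le> m * k" using m k(1) by simp
      have "b n \<le> b (m * k) + b t + ln (2 * real n)"
        using sub[OF mk t(2)] t(1) by simp
      moreover have "b (m * k) \<le> real m * v k"
        using v_mult[OF m k(1)] ln9[OF mk] by (simp add: v_def)
      moreover have "b t \<le> B"
        unfolding B_def using t by (intro Max_ge) auto
      ultimately have "b n \<le> real m * v k + (B + ln (2 * real n))" by linarith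
      then have "b n / real n \<le> (real m * v k + (B + ln (2 * real n))) / real n"
        by (rule divide_right_mono) simp
      moreover have "real m * v k / real n \<le> v k / real k"
      proof -
        have "real m * real k \<le> real n" using t(1) by simp
        then have "(real m * real k) * v k \<le> real n * v k"
          using v_nonneg[OF k(1)] by (rule mult_right_mono)
        then show ?thesis using n k(1) by (simp add: field_simps)
      qed
      ultimately show ?thesis by (simp add: add_divide_distrib)
    qed
    have "(\<lambda>n. (B + ln (2 * real n)) / real n) \<longlonglongrightarrow> 0" by real_asymp
    then have "\<forall>\<^sub>F n in sequentially. (B + ln (2 * real n)) / real n < e / 2"
      using that by (intro order_tendstoD) auto
    then show ?thesis
      using eventually_gt_at_top[of k]
    proof eventually_elim
      case (elim n)
      then show ?case using bound[of n] k(2) by linarith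
    qed
  qed
  have "(\<lambda>n. b n / real n) \<longlonglongrightarrow> \<theta>"
  proof (rule order_tendstoI)
    fix a assume "a < \<theta>"
    have "(\<lambda>n. \<theta> - ln (9 * real n) / real n) \<longlonglongrightarrow> \<theta>" by real_asymp
    then have "\<forall>\<^sub>F n in sequentially. a < \<theta> - ln (9 * real n) / real n"
      using \<open>a < \<theta>\<close> by (rule order_tendstoD)
    then show "\<forall>\<^sub>F n in sequentially. a < b n / real n"
      using eventually_ge_at_top[of 1]
    proof eventually_elim
      case (elim n)
      then show ?case using lower[of n] by linarith
    qed
  next
    fix a assume "\<theta> < a"
    then show "\<forall>\<^sub>F n in sequentially. b n / real n < a"
      using upper[of "a - \<theta>"] by simp
  qed
  then show ?thesis by blast
qed

text \<open>
The index on the right-hand side is \<open>i + j + 1\<close>, so the shifted sequence \<open>a (k - 1)\<close> is the one whose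
logarithm is subadditive up to \<open>ln (2 (k + l))\<close>. The shift does not change the limit of the roots.
\<close>

lemma root_limit_of_supermultiplicative:
  fixes a :: "nat \<Rightarrow> real"
  assumes pos: "\<And>n. 0 < a n" and le_1: "\<And>n. a n \<le> 1"
    and super: "\<And>i j. a i * a j \<le> 2 * real (i + j + 1) * a (i + j + 1)"
  shows "\<exists>L. (\<lambda>n. a n powr (1 / real n)) \<longlonglongrightarrow> L"
proof -
  define b where "b k = - ln (a (k - 1))" for k
  have "\<exists>\<theta>. (\<lambda>n. b n / real n) \<longlonglongrightarrow> \<theta>"
  proof (rule subadditive_log_error_convergent)
    fix n :: nat
    show "0 \<le> b n" using pos le_1 by (simp add: b_def)
  next
    fix k l :: nat assume kl: "1 \<le> k" "1 \<le> l"
    have eq: "(k - 1) + (l - 1) + 1 = k + l - 1" using kl by linarith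
    have "a (k - 1) * a (l - 1) \<le> 2 * real (k + l - 1) * a (k + l - 1)"
      using super[of "k - 1" "l - 1"] unfolding eq .
    also have "\<dots> \<le> 2 * (real k + real l) * a (k + l - 1)"
      using pos[of "k + l - 1"] by (intro mult_right_mono) auto
    finally have "a (k - 1) * a (l - 1) \<le> 2 * (real k + real l) * a (k + l - 1)" .
    then have "ln (a (k - 1) * a (l - 1)) \<le> ln (2 * (real k + real l) * a (k + l - 1))"
      using pos kl by (subst ln_le_cancel_iff) (auto intro!: mult_pos_pos)
    moreover have "ln (2 * (real k + real l) * a (k + l - 1))
        = ln (2 * (real k + real l)) + ln (a (k + l - 1))"
      using pos kl by (intro ln_mult_pos) auto
    moreover have "ln (a (k - 1) * a (l - 1)) = ln (a (k - 1)) + ln (a (l - 1))"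
      using pos by (intro ln_mult_pos)
    ultimately show "b (k + l) \<le> b k + b l + ln (2 * real (k + l))"
      by (simp add: b_def)
  qed
  then obtain \<theta> where "(\<lambda>n. b n / real n) \<longlonglongrightarrow> \<theta>" by blast
  then have "(\<lambda>n. b (Suc n) / real (Suc n)) \<longlonglongrightarrow> \<theta>" by (rule LIMSEQ_Suc)
  moreover have "(\<lambda>n. real (Suc n) / real n) \<longlonglongrightarrow> 1" by real_asymp
  ultimately have "(\<lambda>n. b (Suc n) / real (Suc n) * (real (Suc n) / real n)) \<longlonglongrightarrow> \<theta> * 1"
    by (rule tendsto_mult)
  then have "(\<lambda>n. exp (- (b (Suc n) / real (Suc n) * (real (Suc n) / real n)))) \<longlonglongrightarrow> exp (- \<theta>)"
    by (intro tendsto_intros) simp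
  moreover have "exp (- (b (Suc n) / real (Suc n) * (real (Suc n) / real n)))
      = a n powr (1 / real n)" for n
    using pos[of n] by (simp add: b_def powr_def del: of_nat_Suc)
  ultimately show ?thesis by auto
qed

lemma root_limit_le:
  fixes a :: "nat \<Rightarrow> real"
  assumes lim: "(\<lambda>n. a n powr (1 / real n)) \<longlonglongrightarrow> L"
    and "0 < c" "0 < \<mu>" and a: "\<forall>\<^sub>F n in sequentially. 0 \<le> a n \<and> a n \<le> c * \<mu> ^ n"
  shows "L \<le> \<mu>"
proof (rule tendsto_le[OF _ _ lim])
  show "(\<lambda>n. c powr (1 / real n) * \<mu>) \<longlonglongrightarrow> \<mu>" using assms(2) by real_asymp
  show "\<forall>\<^sub>F n in sequentially. a n powr (1 / real n) \<le> c powr (1 / real n) * \<mu>"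
    using a eventually_gt_at_top[of 0]
  proof eventually_elim
    case (elim n)
    then have "a n powr (1 / real n) \<le> (c * \<mu> ^ n) powr (1 / real n)"
      by (intro powr_mono2) auto
    also have "\<dots> = c powr (1 / real n) * \<mu>"
      using assms(2,3) elim by (simp add: powr_mult powr_powr flip: powr_realpow)
    finally show ?case .
  qed
qed simp

lemma root_limit_ge:
  fixes a :: "nat \<Rightarrow> real"
  assumes lim: "(\<lambda>n. a n powr (1 / real n)) \<longlonglongrightarrow> L"
    and "0 < c" "0 < \<mu>" and a: "\<forall>\<^sub>F n in sequentially. c * \<mu> ^ n \<le> a n"
  shows "\<mu> \<le> L"
proof (rule tendsto_le[OF _ lim])
  show "(\<lambda>n. c powr (1 / real n) * \<mu>) \<longlonglongrightarrow> \<mu>" using assms(2) by real_asymp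
  show "\<forall>\<^sub>F n in sequentially. c powr (1 / real n) * \<mu> \<le> a n powr (1 / real n)"
    using a eventually_gt_at_top[of 0]
  proof eventually_elim
    case (elim n)
    have "c powr (1 / real n) * \<mu> = (c * \<mu> ^ n) powr (1 / real n)"
      using assms(2,3) elim by (simp add: powr_mult powr_powr flip: powr_realpow)
    also have "\<dots> \<le> a n powr (1 / real n)"
      using elim assms(2,3) by (intro powr_mono2) auto
    finally show ?case .
  qed
qed simp

text \<open>
The coefficient form of $f f' = (f^2 / 2)'$.
\<close>

lemma conv_weighted_self:
  "conv f (\<lambda>n. real (Suc n) * f (Suc n)) n = real (Suc n) / 2 * conv f f (Suc n)"
proof -
  define N where "N = Suc n"
  define X where "X = (\<Sum>i\<le>N. real (N - i) * (f i * f (N - i)))"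
  have "conv f (\<lambda>n. real (Suc n) * f (Suc n)) n = X"
    unfolding conv_def X_def N_def
    by (auto simp: Suc_diff_le of_nat_diff algebra_simps intro!: sum.cong)
  moreover have "X = (\<Sum>i\<le>N. real i * (f i * f (N - i)))"
    unfolding X_def
    by (rule sum.reindex_bij_witness[of _ "\<lambda>i. N - i" "\<lambda>i. N - i"]) auto
  then have "X + X = real N * conv f f N"
    unfolding conv_def sum_distrib_left
    by (subst (1) X_def, simp only: sum.distrib[symmetric])
      (auto simp: of_nat_diff algebra_simps intro!: sum.cong)
  then have "X = real N / 2 * conv f f N" by simp
  ultimately show ?thesis by (simp add: N_def)
qed

text \<open>
The coefficient form of $q \ge p^2 / 2$, which follows by integrating $q' \ge p p'$.
\<close>

lemma half_conv_le_two_blocks: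
  "conv (block_density 1) (block_density 1) n / 2 \<le> block_density 2 n"
proof (cases n)
  case 0
  then show ?thesis by (simp add: conv_def block_density_0_right)
next
  case (Suc m)
  have "real (Suc m) / 2 * conv (block_density 1) (block_density 1) (Suc m)
      = conv (block_density 1) at_most_two_blocks m"
    by (simp only: conv_weighted_self[symmetric] block_density_1_Suc)
  also have "\<dots> \<le> real (Suc m) * block_density 2 (Suc m)"
    unfolding block_density_2_Suc by simp
  finally have "real (Suc m) * (conv (block_density 1) (block_density 1) (Suc m) / 2)
      \<le> real (Suc m) * block_density 2 (Suc m)"
    by simp
  then show ?thesis unfolding Suc by (rule mult_left_le_imp_le) simp
qed

definition sorted_density :: "nat \<Rightarrow> real" where
  "sorted_density n = \<delta> n + block_density 1 n"

lemma sorted_density_Suc: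
  "real (Suc n) * sorted_density (Suc n) = sorted_density n + block_density 2 n"
  using block_density_1_Suc[of n] by (simp add: sorted_density_def \<delta>_def)

lemma sorted_density_pos: "0 < sorted_density n"
proof (induction n)
  case (Suc n)
  then have "0 < real (Suc n) * sorted_density (Suc n)"
    unfolding sorted_density_Suc by (intro add_pos_nonneg) auto
  then show ?case by (simp add: zero_less_mult_iff)
qed (simp add: sorted_density_def \<delta>_def block_density_0_right)

lemma sorted_density_le_1: "sorted_density n \<le> 1"
proof -
  have "finite (S n)" "card (S n) = fact n" by (simp_all add: S_def)
  then have "card (stack_sort ` S n) \<le> fact n" by (metis card_image_le)
  then have "real (card (stack_sort ` S n)) \<le> fact n"
    using of_nat_mono[where ?'a = real] by fastforce
  then show ?thesis
    unfolding sorted_density_def card_stack_sort_image[symmetric] by simp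
qed

lemma sorted_density_super:
  "sorted_density i * sorted_density j \<le> 2 * real (i + j + 1) * sorted_density (i + j + 1)"
proof -
  have rec: "real (i + j + 1) * sorted_density (i + j + 1)
      = sorted_density (i + j) + block_density 2 (i + j)"
    using sorted_density_Suc[of "i + j"] by simp
  have "sorted_density i * sorted_density j
      \<le> 2 * (sorted_density (i + j) + block_density 2 (i + j))"
  proof (cases "i = 0 \<or> j = 0")
    case True
    then have eq: "sorted_density i * sorted_density j = sorted_density (i + j)"
      by (auto simp: sorted_density_def \<delta>_def block_density_0_right)
    show ?thesis
      unfolding eq distrib_left
      using sorted_density_pos[of "i + j"] block_density_nonneg[of 2 "i + j"]
      by (intro add_increasing2) auto
  next
    case False
    then have "sorted_density i * sorted_density j = block_density 1 i * block_density 1 (i + j - i)"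
      by (simp add: sorted_density_def \<delta>_def)
    also have "\<dots> \<le> conv (block_density 1) (block_density 1) (i + j)"
      unfolding conv_def by (rule member_le_sum) auto
    also have "\<dots> \<le> 2 * block_density 2 (i + j)"
      using half_conv_le_two_blocks[of "i + j"] by linarith
    finally show ?thesis
      unfolding distrib_left using less_imp_le[OF sorted_density_pos[of "i + j"]]
      by (intro add_increasing) auto
  qed
  then show ?thesis unfolding rec[symmetric] by (simp only: mult.assoc)
qed


section \<open>Comparison with super- and subsolutions\<close>

text \<open>
If two sequences agree with polynomials from index \<open>d\<close> on, then their Cauchy product at \<open>2 d + m\<close> is
a polynomial in \<open>m\<close>: at that index no summand pairs two of the exceptional values. The next two
lemmas compute it for a linear and a quadratic polynomial, written in powers of \<open>i - d\<close>.
\<close>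

lemma sum_linear_times_quadratic:
  fixes x0 x1 y0 y1 y2 :: real
  shows "(\<Sum>j\<le>m. (x0 + x1 * real j) * (y0 + y1 * real (m - j) + y2 * (real (m - j))\<^sup>2))
    = x0 * (y0 * (real m + 1) + y1 * (real m * (real m + 1) / 2) + y2 * (real m * (real m + 1) * (2 * real m + 1) / 6))
      + x1 * (y0 * (real m * (real m + 1) / 2) + y1 * ((real m - 1) * real m * (real m + 1) / 6)
        + y2 * (real m * real m * (real m + 1) * (real m - 1) / 12))"
    (is "?lhs m = _")
proof -
  have cubic: "(\<Sum>j\<le>m. c0 + c1 * real j + c2 * (real j)\<^sup>2 + c3 * (real j) ^ 3)
      = c0 * (real m + 1) + c1 * (real m * (real m + 1) / 2) + c2 * (real m * (real m + 1) * (2 * real m + 1) / 6)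
        + c3 * (real m * (real m + 1) / 2)\<^sup>2" for c0 c1 c2 c3 :: real
    by (induction m) (simp_all add: field_simps power2_eq_square power3_eq_cube)
  have "?lhs m = (\<Sum>j\<le>m. x0 * (y0 + y1 * real m + y2 * (real m)\<^sup>2)
      + (x1 * (y0 + y1 * real m + y2 * (real m)\<^sup>2) - x0 * (y1 + 2 * y2 * real m)) * real j
      + (x0 * y2 - x1 * (y1 + 2 * y2 * real m)) * (real j)\<^sup>2 + x1 * y2 * (real j) ^ 3)"
    by (intro sum.cong) (auto simp: of_nat_diff field_simps power2_eq_square power3_eq_cube)
  then show ?thesis
    unfolding cubic by (simp add: field_simps power2_eq_square power3_eq_cube)
qed

lemma conv_tails:
  fixes a a' b b' b'' :: real
  assumes A: "\<And>i. d \<le> i \<Longrightarrow> A i = a + a' * (real i - real d)"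
    and B: "\<And>i. d \<le> i \<Longrightarrow> B i = b + b' * (real i - real d) + b'' * (real i - real d)\<^sup>2"
  shows "conv A B (2 * d + m) =
    (\<Sum>i<d. A i * (b + b' * (real (d + m) - real i) + b'' * (real (d + m) - real i)\<^sup>2))
    + (\<Sum>i<d. B i * (a + a' * (real (d + m) - real i)))
    + a * (b * (real m + 1) + b' * (real m * (real m + 1) / 2) + b'' * (real m * (real m + 1) * (2 * real m + 1) / 6))
    + a' * (b * (real m * (real m + 1) / 2) + b' * ((real m - 1) * real m * (real m + 1) / 6)
        + b'' * (real m * real m * (real m + 1) * (real m - 1) / 12))"
proof -
  let ?n = "2 * d + m"
  let ?f = "\<lambda>i. A i * B (?n - i)"
  have split: "{..?n} = ({..<d} \<union> (\<lambda>j. d + j) ` {..m}) \<union> (\<lambda>i. ?n - i) ` {..<d}"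
  proof (intro equalityI subsetI)
    fix i assume i: "i \<in> {..?n}"
    consider "i < d" | "d \<le> i" "i \<le> d + m" | "d + m < i" by linarith
    then show "i \<in> ({..<d} \<union> (\<lambda>j. d + j) ` {..m}) \<union> (\<lambda>i. ?n - i) ` {..<d}"
    proof cases
      case 2
      then have "i = d + (i - d)" "i - d \<in> {..m}" by auto
      then show ?thesis by blast
    next
      case 3
      then have "i = ?n - (?n - i)" "?n - i \<in> {..<d}" using i by auto
      then show ?thesis by blast
    qed auto
  qed auto
  have "conv A B ?n = sum ?f {..<d} + sum ?f ((\<lambda>j. d + j) ` {..m})
      + sum ?f ((\<lambda>i. ?n - i) ` {..<d})"
    unfolding conv_def split
    by (subst sum.union_disjoint, simp, simp, force)
      (subst sum.union_disjoint, simp, simp, force, rule refl)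
  also have "sum ?f ((\<lambda>j. d + j) ` {..m})
      = (\<Sum>j\<le>m. (a + a' * real j) * (b + b' * real (m - j) + b'' * (real (m - j))\<^sup>2))"
    by (subst sum.reindex) (auto simp: A B of_nat_diff intro!: sum.cong)
  also have "sum ?f ((\<lambda>i. ?n - i) ` {..<d}) = (\<Sum>i<d. B i * (a + a' * (real (d + m) - real i)))"
    by (subst sum.reindex) (auto simp: A of_nat_diff inj_on_def intro!: sum.cong)
  also have "sum ?f {..<d}
      = (\<Sum>i<d. A i * (b + b' * (real (d + m) - real i) + b'' * (real (d + m) - real i)\<^sup>2))"
    by (intro sum.cong) (auto simp: B of_nat_diff algebra_simps)
  finally show ?thesis unfolding sum_linear_times_quadratic by simp
qed

lemma conv_scale: "conv (\<lambda>i. f i * \<rho> ^ i) (\<lambda>i. g i * \<rho> ^ i) n = conv f g n * \<rho> ^ n"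
proof -
  have "f i * \<rho> ^ i * (g (n - i) * \<rho> ^ (n - i)) = f i * g (n - i) * \<rho> ^ n" if "i \<le> n" for i
  proof -
    have "\<rho> ^ n = \<rho> ^ i * \<rho> ^ (n - i)" using that by (simp flip: power_add)
    then show ?thesis by simp
  qed
  then show ?thesis unfolding conv_def sum_distrib_right by (intro sum.cong) auto
qed

text \<open>
One induction step of a comparison. The sequences are multiplied by \<open>\<rho> ^ n\<close>, and raising the index
by one costs a factor \<open>\<rho>\<close> on the right-hand side of the recurrence.
\<close>

lemma scaled_step_le:
  fixes \<rho> a b x y :: real
  assumes "real (Suc n) * a \<le> x" "x * \<rho> ^ n \<le> y" "\<rho> * y \<le> real (Suc n) * b" "0 \<le> \<rho>"
  shows "a * \<rho> ^ Suc n \<le> b"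
proof -
  have "real (Suc n) * (a * \<rho> ^ Suc n) = \<rho> * ((real (Suc n) * a) * \<rho> ^ n)"
    by (simp add: mult_ac)
  also have "\<dots> \<le> \<rho> * (x * \<rho> ^ n)"
    using assms by (intro mult_left_mono mult_right_mono) auto
  also have "\<dots> \<le> \<rho> * y" using assms by (intro mult_left_mono)
  also have "\<dots> \<le> real (Suc n) * b" by fact
  finally show ?thesis by (simp del: of_nat_Suc)
qed

lemma scaled_step_ge:
  fixes \<rho> a b x y :: real
  assumes "x \<le> real (Suc n) * a" "y \<le> x * \<rho> ^ n" "real (Suc n) * b \<le> \<rho> * y" "0 \<le> \<rho>"
  shows "b \<le> a * \<rho> ^ Suc n"
  using scaled_step_le[of n "- a" "- x" \<rho> "- y" "- b"] assms by simp

lemma le_majorants: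
  fixes p q P Q :: "nat \<Rightarrow> real"
  assumes nonneg: "\<And>n. 0 \<le> p n" "\<And>n. 0 \<le> q n" and \<rho>: "0 \<le> \<rho>"
    and p: "\<And>n. real (Suc n) * p (Suc n) \<le> \<delta> n + p n + q n"
    and q: "\<And>n. real (Suc n) * q (Suc n) \<le> conv p (\<lambda>n. \<delta> n + p n + q n) n + conv p q n"
    and init: "p 0 \<le> P 0" "q 0 \<le> Q 0"
    and P: "\<And>n. \<rho> * (\<delta> n + P n + Q n) \<le> real (Suc n) * P (Suc n)"
    and Q: "\<And>n. \<rho> * (conv P (\<lambda>n. \<delta> n + P n + Q n) n + conv P Q n) \<le> real (Suc n) * Q (Suc n)"
  shows "p n * \<rho> ^ n \<le> P n \<and> q n * \<rho> ^ n \<le> Q n"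
proof (induction n rule: less_induct)
  case (less n)
  show ?case
  proof (cases n)
    case 0
    then show ?thesis using init by simp
  next
    case (Suc m)
    define w where "w n = \<delta> n + p n + q n" for n
    define W where "W n = \<delta> n + P n + Q n" for n
    have IH: "p i * \<rho> ^ i \<le> P i" "q i * \<rho> ^ i \<le> Q i" if "i \<le> m" for i
      using less[of i] that Suc by auto
    have \<delta>\<rho>: "\<delta> i * \<rho> ^ i = \<delta> i" for i by (simp add: \<delta>_def)
    have W: "w i * \<rho> ^ i \<le> W i" if "i \<le> m" for i
      unfolding w_def W_def distrib_right \<delta>\<rho> using IH[OF that] by linarith
    have w0: "0 \<le> w i" for i using nonneg by (simp add: w_def \<delta>_def)
    have "p (Suc m) * \<rho> ^ Suc m \<le> P (Suc m)"
      using p[folded w_def] W[OF order_refl] P[folded W_def] \<rho> by (rule scaled_step_le)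
    moreover have "(conv p w m + conv p q m) * \<rho> ^ m \<le> conv P W m + conv P Q m"
      unfolding distrib_right conv_scale[symmetric]
      using IH W nonneg w0 \<rho> by (intro add_mono conv_mono) auto
    then have "q (Suc m) * \<rho> ^ Suc m \<le> Q (Suc m)"
      using q[folded w_def] Q[folded W_def] \<rho> by (intro scaled_step_le)
    ultimately show ?thesis using Suc by simp
  qed
qed

lemma minorants_le:
  fixes p q r s P Q R T :: "nat \<Rightarrow> real"
  assumes nonneg: "\<And>n. 0 \<le> P n" "\<And>n. 0 \<le> Q n" "\<And>n. 0 \<le> R n" "\<And>n. 0 \<le> T n" and \<rho>: "0 \<le> \<rho>"
    and p: "\<And>n. \<delta> n + p n + q n \<le> real (Suc n) * p (Suc n)"
    and q: "\<And>n. conv p (\<lambda>n. \<delta> n + p n + q n) n + r n \<le> real (Suc n) * q (Suc n)"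
    and r: "\<And>n. conv q (\<lambda>n. \<delta> n + p n + q n) n + conv p r n + s n \<le> real (Suc n) * r (Suc n)"
    and s: "\<And>n. conv r (\<lambda>n. \<delta> n + p n + q n) n + conv q r n + conv p s n \<le> real (Suc n) * s (Suc n)"
    and init: "P 0 \<le> p 0" "Q 0 \<le> q 0" "R 0 \<le> r 0" "T 0 \<le> s 0"
    and P: "\<And>n. real (Suc n) * P (Suc n) \<le> \<rho> * (\<delta> n + P n + Q n)"
    and Q: "\<And>n. real (Suc n) * Q (Suc n) \<le> \<rho> * (conv P (\<lambda>n. \<delta> n + P n + Q n) n + R n)"
    and R: "\<And>n. real (Suc n) * R (Suc n)
      \<le> \<rho> * (conv Q (\<lambda>n. \<delta> n + P n + Q n) n + conv P R n + T n)"
    and T: "\<And>n. real (Suc n) * T (Suc n)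
      \<le> \<rho> * (conv R (\<lambda>n. \<delta> n + P n + Q n) n + conv Q R n + conv P T n)"
  shows "P n \<le> p n * \<rho> ^ n \<and> Q n \<le> q n * \<rho> ^ n \<and> R n \<le> r n * \<rho> ^ n \<and> T n \<le> s n * \<rho> ^ n"
proof (induction n rule: less_induct)
  case (less n)
  show ?case
  proof (cases n)
    case 0
    then show ?thesis using init by simp
  next
    case (Suc m)
    define w where "w n = \<delta> n + p n + q n" for n
    define W where "W n = \<delta> n + P n + Q n" for n
    have IH: "P i \<le> p i * \<rho> ^ i" "Q i \<le> q i * \<rho> ^ i" "R i \<le> r i * \<rho> ^ i" "T i \<le> s i * \<rho> ^ i"
      if "i \<le> m" for i
      using less[of i] that Suc by auto
    have \<delta>\<rho>: "\<delta> i * \<rho> ^ i = \<delta> i" for i by (simp add: \<delta>_def)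
    have W: "W i \<le> w i * \<rho> ^ i" if "i \<le> m" for i
      unfolding w_def W_def distrib_right \<delta>\<rho> using IH[OF that] by linarith
    have W0: "0 \<le> W i" for i using nonneg by (simp add: W_def \<delta>_def)
    have "P (Suc m) \<le> p (Suc m) * \<rho> ^ Suc m"
      using p[folded w_def] W[OF order_refl] P[folded W_def] \<rho> by (rule scaled_step_ge)
    moreover have "conv P W m + R m \<le> (conv p w m + r m) * \<rho> ^ m"
      unfolding distrib_right conv_scale[symmetric]
      using IH W nonneg W0 by (intro add_mono conv_mono) auto
    then have "Q (Suc m) \<le> q (Suc m) * \<rho> ^ Suc m"
      using q[folded w_def] Q[folded W_def] \<rho> by (intro scaled_step_ge)
    moreover have "conv Q W m + conv P R m + T m \<le> (conv q w m + conv p r m + s m) * \<rho> ^ m"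
      unfolding distrib_right conv_scale[symmetric]
      using IH W nonneg W0 by (intro add_mono conv_mono) auto
    then have "R (Suc m) \<le> r (Suc m) * \<rho> ^ Suc m"
      using r[folded w_def] R[folded W_def] \<rho> by (intro scaled_step_ge)
    moreover have "conv R W m + conv Q R m + conv P T m
        \<le> (conv r w m + conv q r m + conv p s m) * \<rho> ^ m"
      unfolding distrib_right conv_scale[symmetric]
      using IH W nonneg W0 by (intro add_mono conv_mono) auto
    then have "T (Suc m) \<le> s (Suc m) * \<rho> ^ Suc m"
      using s[folded w_def] T[folded W_def] \<rho> by (intro scaled_step_ge)
    ultimately show ?thesis using Suc by simp
  qed
qed

section \<open>The upper bound\<close>

text \<open>
A supersolution for \<open>\<rho> = 4 / 3\<close>. The four exceptional values are those of the system
$p' = 1 + p + q$, $q' = p p' + p q$ itself, multiplied by \<open>\<rho> ^ n\<close>. The linear polynomial in \<open>majorant2\<close> is forced by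
equality in the first recurrence for a constant \<open>majorant1\<close>, here \<open>7 / 10\<close>. Comparing the leading
terms in the second recurrence, the constant must not exceed \<open>1 / \<rho> = 3 / 4\<close>; comparing the values at
4, it must be at least \<open>160 / 243\<close>.
\<close>

definition majorant1 :: "nat \<Rightarrow> real" where
  "majorant1 n = (if n < 4 then [0, 4 / 3, 8 / 9, 64 / 81] ! n else 7 / 10)"

definition majorant2 :: "nat \<Rightarrow> real" where
  "majorant2 n = (if n < 4 then [0, 0, 8 / 9, 32 / 27] ! n else (21 * real n - 7) / 40)"

lemma majorant1_step: "4 / 3 * (\<delta> n + majorant1 n + majorant2 n) \<le> real (Suc n) * majorant1 (Suc n)"
proof (cases "n < 4")
  case True
  then have "n \<in> {0, 1, 2, 3}" by auto
  then show ?thesis by (auto simp: \<delta>_def majorant1_def majorant2_def)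
next
  case False
  then show ?thesis by (simp add: \<delta>_def majorant1_def majorant2_def field_simps)
qed

lemma majorant2_step:
  "4 / 3 * (conv majorant1 (\<lambda>n. \<delta> n + majorant1 n + majorant2 n) n
      + conv majorant1 majorant2 n)
    \<le> real (Suc n) * majorant2 (Suc n)"
proof (cases "n < 8")
  case True
  then have "n \<in> {0, 1, 2, 3, 4, 5, 6, 7}" by auto
  then show ?thesis
    by (auto simp: \<delta>_def majorant1_def majorant2_def conv_def atMost_nat_numeral atMost_Suc)
next
  case False
  define m where "m = n - 8"
  have n: "n = 2 * 4 + m" using False by (simp add: m_def)
  have w: "conv majorant1 (\<lambda>n. \<delta> n + majorant1 n + majorant2 n) (2 * 4 + m)
      = (1130990 + 233457 * real m + 11907 * (real m)\<^sup>2) / 64800"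
    by (subst conv_tails[where a = "7 / 10" and a' = 0 and b = "21 / 8" and b' = "21 / 40" and b'' = 0])
      (simp_all add: majorant1_def majorant2_def \<delta>_def lessThan_nat_numeral lessThan_Suc
        field_simps power2_eq_square)
  have q: "conv majorant1 majorant2 (2 * 4 + m)
      = (780598 + 201705 * real m + 11907 * (real m)\<^sup>2) / 64800"
    by (subst conv_tails[where a = "7 / 10" and a' = 0 and b = "77 / 40" and b' = "21 / 40" and b'' = 0])
      (simp_all add: majorant1_def majorant2_def \<delta>_def lessThan_nat_numeral lessThan_Suc
        field_simps power2_eq_square)
  show ?thesis
    unfolding n w q by (simp add: majorant2_def field_simps power2_eq_square)
qed

section \<open>The lower bound\<close>

text \<open>
A subsolution for \<open>\<rho> = 1457 / 1000\<close>, just below \<open>1 / 0.68631\<close>. The exceptional values come from the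
four recurrences, multiplied by \<open>\<rho> ^ n\<close> and rounded down to three decimals at each step. After that
\<open>minorant1\<close> is a constant, the linear polynomial of \<open>minorant2\<close> is what the first recurrence
demands, the quadratic polynomial of \<open>minorant3\<close> is what the second one demands, both rounded
upwards, and \<open>minorant4\<close> is dropped. This leaves the third recurrence as the real condition. It
holds because of the exceptional values: they outweigh the constant \<open>88 / 100\<close> on average, and eight
of them suffice.
\<close>

definition minorant1 :: "nat \<Rightarrow> real" where
  "minorant1 n = (if n < 8 then [0, 1457, 1061, 1030, 938, 929, 902, 900] ! n / 1000 else 88 / 100)"

definition minorant2 :: "nat \<Rightarrow> real" where
  "minorant2 n = (if n < 8 then [0, 0, 1061, 1546, 2252, 2788, 3424, 4016] ! n / 1000
    else (604 * real n - 276) / 1000)"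

definition minorant3 :: "nat \<Rightarrow> real" where
  "minorant3 n = (if n < 8 then [0, 0, 0, 515, 1126, 2241, 3597, 5417] ! n / 1000
    else (1488 * (real n)\<^sup>2 - 2640 * real n - 4900) / 10000)"

definition minorant4 :: "nat \<Rightarrow> real" where
  "minorant4 n = (if n < 8 then [0, 0, 0, 0, 187, 546, 1406, 2823] ! n / 1000 else 0)"

lemmas minorant_defs = minorant1_def minorant2_def minorant3_def minorant4_def

lemma minorant_nonneg:
  shows "0 \<le> minorant1 n" "0 \<le> minorant2 n" "0 \<le> minorant3 n" "0 \<le> minorant4 n"
proof -
  have *: "n < 8 \<Longrightarrow> n \<in> {0, 1, 2, 3, 4, 5, 6, 7}" by auto
  show "0 \<le> minorant1 n" "0 \<le> minorant2 n" "0 \<le> minorant4 n"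
    using * by (auto simp: minorant_defs)
  show "0 \<le> minorant3 n"
  proof (cases "n < 8")
    case False
    then have n: "8 \<le> real n" by simp
    then have "8 * real n \<le> real n * real n" by (intro mult_right_mono) auto
    then have "0 \<le> 1488 * (real n * real n) - 2640 * real n - 4900" using n by linarith
    then show ?thesis using False by (simp add: minorant3_def power2_eq_square)
  qed (use * in \<open>auto simp: minorant3_def\<close>)
qed

lemma minorant1_step:
  "real (Suc n) * minorant1 (Suc n)
    \<le> 1457 / 1000 * (\<delta> n + minorant1 n + minorant2 n)"
proof (cases "n < 8")
  case True
  then have "n \<in> {0, 1, 2, 3, 4, 5, 6, 7}" by auto
  then show ?thesis by (auto simp: \<delta>_def minorant1_def minorant2_def)
next
  case False
  then show ?thesis by (simp add: \<delta>_def minorant1_def minorant2_def field_simps)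
qed

abbreviation "minorant_at_most_two \<equiv> \<lambda>n. \<delta> n + minorant1 n + minorant2 n"

lemma less_16_cases: "(n::nat) < 16 \<Longrightarrow> n \<in> {0, 1, 2, 3, 4, 5, 6, 7, 8, 9, 10, 11, 12, 13, 14, 15}"
  by (simp only: numeral_eq_Suc pred_numeral_simps BitM.simps insert_iff empty_iff) (auto simp: less_Suc_eq)

lemma minorant2_step:
  "real (Suc n) * minorant2 (Suc n)
    \<le> 1457 / 1000 * (conv minorant1 minorant_at_most_two n + minorant3 n)"
proof (cases "n < 16")
  case True
  from less_16_cases[OF this] show ?thesis
    by (auto simp: \<delta>_def minorant_defs conv_def atMost_nat_numeral atMost_Suc)
next
  case False
  define m where "m = n - 16"
  have n: "n = 2 * 8 + m" using False by (simp add: m_def)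
  have w: "conv minorant1 minorant_at_most_two (2 * 8 + m)
      = (20805361 + 2352127 * real m + 66440 * (real m)\<^sup>2) / 250000"
    by (subst conv_tails[where a = "22 / 25" and a' = 0
          and b = "1359 / 250" and b' = "151 / 250" and b'' = 0])
      (simp_all add: minorant_defs \<delta>_def lessThan_nat_numeral lessThan_Suc
        field_simps power2_eq_square)
  show ?thesis
    unfolding n w by (simp add: minorant2_def minorant3_def field_simps power2_eq_square)
qed

lemma minorant3_step: "real (Suc n) * minorant3 (Suc n)
    \<le> 1457 / 1000 * (conv minorant2 minorant_at_most_two n + conv minorant1 minorant3 n + minorant4 n)"
proof (cases "n < 16")
  case True
  from less_16_cases[OF this] show ?thesis
    by (auto simp: \<delta>_def minorant_defs conv_def atMost_nat_numeral atMost_Suc)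
next
  case False
  define m where "m = n - 16"
  have n: "n = 2 * 8 + m" using False by (simp add: m_def)
  have w: "conv minorant2 minorant_at_most_two (2 * 8 + m) =
      (215715045 + 38183521 * real m + 2263188 * (real m)\<^sup>2 + 45602 * (real m) ^ 3) / 750000"
    by (subst conv_tails[where a = "1139 / 250" and a' = "151 / 250"
          and b = "1359 / 250" and b' = "151 / 250" and b'' = 0])
      (simp_all add: minorant_defs \<delta>_def lessThan_nat_numeral lessThan_Suc
        field_simps power2_eq_square power3_eq_cube)
  have r: "conv minorant1 minorant3 (2 * 8 + m) =
      (393019679 + 78834796 * real m + 5176884 * (real m)\<^sup>2 + 109120 * (real m) ^ 3) / 2500000"
    by (subst conv_tails[where a = "22 / 25" and a' = 0
          and b = "17303 / 2500" and b' = "1323 / 625" and b'' = "93 / 625"])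
      (simp_all add: minorant_defs \<delta>_def lessThan_nat_numeral lessThan_Suc
        field_simps power2_eq_square power3_eq_cube)
  show ?thesis
    unfolding n w r
    by (simp add: minorant3_def minorant4_def field_simps power2_eq_square power3_eq_cube)
qed

lemma conv_nonneg: "(\<And>i. 0 \<le> f i) \<Longrightarrow> (\<And>i. 0 \<le> g i) \<Longrightarrow> 0 \<le> conv f g n"
  unfolding conv_def by (intro sum_nonneg mult_nonneg_nonneg)

lemma minorant4_step: "real (Suc n) * minorant4 (Suc n)
    \<le> 1457 / 1000 * (conv minorant3 minorant_at_most_two n + conv minorant2 minorant3 n + conv minorant1 minorant4 n)"
proof (cases "n < 7")
  case True
  then have "n \<in> {0, 1, 2, 3, 4, 5, 6}" by auto
  then show ?thesis
    by (auto simp: \<delta>_def minorant_defs conv_def atMost_nat_numeral atMost_Suc)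
next
  case False
  have "0 \<le> \<delta> i" for i by (simp add: \<delta>_def)
  then have "0 \<le> conv minorant3 minorant_at_most_two n + conv minorant2 minorant3 n + conv minorant1 minorant4 n"
    by (intro add_nonneg_nonneg conv_nonneg minorant_nonneg) auto
  then show ?thesis using False by (simp add: minorant4_def)
qed

lemma sorted_density_upper:
  assumes "4 \<le> n"
  shows "sorted_density n \<le> 7 / 10 * (3 / 4) ^ n"
proof -
  have "block_density 1 n * (4 / 3) ^ n \<le> majorant1 n \<and> block_density 2 n * (4 / 3) ^ n \<le> majorant2 n"
  proof (rule le_majorants)
    fix n
    show "real (Suc n) * block_density 2 (Suc n)
        \<le> conv (block_density 1) at_most_two_blocks n + conv (block_density 1) (block_density 2) n"
      unfolding block_density_2_Suc
      using block_density_add_le[of 1 2 n] by (simp del: One_nat_def)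
  qed (simp_all only: block_density_1_Suc majorant1_step majorant2_step block_density_nonneg
      order_refl, simp_all add: block_density_0_right majorant1_def majorant2_def)
  then have "block_density 1 n * (4 / 3) ^ n \<le> 7 / 10"
    using assms by (simp add: majorant1_def)
  then show ?thesis
    using assms by (simp add: sorted_density_def \<delta>_def power_divide field_simps)
qed

lemma sorted_density_lower:
  assumes "8 \<le> n"
  shows "88 / 100 * (1000 / 1457) ^ n \<le> sorted_density n"
proof -
  have "minorant1 n \<le> block_density 1 n * (1457 / 1000) ^ n
      \<and> minorant2 n \<le> block_density 2 n * (1457 / 1000) ^ n
      \<and> minorant3 n \<le> block_density 3 n * (1457 / 1000) ^ n
      \<and> minorant4 n \<le> block_density 4 n * (1457 / 1000) ^ n"
    by (rule minorants_le[OF minorant_nonneg _ _ _ _ block_density_4_Suc _ _ _ _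
          minorant1_step minorant2_step minorant3_step minorant4_step])
      (simp_all only: block_density_1_Suc block_density_2_Suc block_density_3_Suc order_refl,
        simp_all add: minorant_defs block_density_0_right)
  then have "88 / 100 \<le> block_density 1 n * (1457 / 1000) ^ n"
    using assms by (simp add: minorant1_def)
  then show ?thesis
    using assms by (simp add: sorted_density_def \<delta>_def power_divide field_simps)
qed

theorem theorem7p28:
  shows "\<exists>L::real.
    (\<lambda>n::nat. (real (card (stack_sort ` S n)) / fact n) powr (1 / real n)) \<longlonglongrightarrow> L
    \<and> 0.68631 < L \<and> L < 0.75260"
proof -
  obtain L where L: "(\<lambda>n. sorted_density n powr (1 / real n)) \<longlonglongrightarrow> L"
    using root_limit_of_supermultiplicative[OF sorted_density_pos sorted_density_le_1
        sorted_density_super] by blast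
  have "L \<le> 3 / 4"
  proof (rule root_limit_le[OF L, of "7 / 10"])
    show "\<forall>\<^sub>F n in sequentially.
        0 \<le> sorted_density n \<and> sorted_density n \<le> 7 / 10 * (3 / 4) ^ n"
      by (intro eventually_sequentiallyI[of 4] conjI less_imp_le[OF sorted_density_pos]
          sorted_density_upper)
  qed simp_all
  moreover have "1000 / 1457 \<le> L"
  proof (rule root_limit_ge[OF L, of "88 / 100"])
    show "\<forall>\<^sub>F n in sequentially. 88 / 100 * (1000 / 1457) ^ n \<le> sorted_density n"
      by (intro eventually_sequentiallyI[of 8] sorted_density_lower)
  qed simp_all
  ultimately show ?thesis
    using L unfolding card_stack_sort_image sorted_density_def[symmetric]
    by (intro exI[of _ L]) simp
qed

end
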